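(* Let $N\ge2$ and let $(S_i)_{i\in\mathbb{Z}_N}$ be a purely atomic representation of the Cuntz algebra $\mathcal{O}_N$ on a Hilbert space $\mathcal{H}$ with associated projection valued measure $P$. If the representation has a finite dimensional subspace $M$ which is cyclic for the representation and invariant for all $S_i^*$, $i\in\mathbb{Z}_N$, then the support of $P$ contains only periodic points, and for all cycles $\omega$ in the support, $P(\omega)\mathcal{H}$ is contained in $M$.
   Context: $\mathbb{Z}_N=\{0,1,\dots,N-1\}$. A representation of the Cuntz algebra $\mathcal{O}_N$ on a Hilbert space $\mathcal{H}$ is a family $(S_i)_{i\in\mathbb{Z}_N}$ of bounded operators on $\mathcal{H}$ with $S_i^*S_j=\delta_{ij}I$ for all $i,j$ and $\sum_{i\in\mathbb{Z}_N}S_iS_i^*=I$. For a finite word $I=i_1\dots i_n$, $S_I:=S_{i_1}\cdots S_{i_n}$ ($S_\emptyset$ is the identity). $\mathcal{K}_N=\mathbb{Z}_N^{\mathbb{N}}$ is the space of infinite words with the product topology and $\sigma(\omega_1\omega_2\dots)=\omega_2\omega_3\dots$ is the shift. The projection valued measure $P$ associated to the representation is the unique projection valued measure on the Borel sets of $\mathcal{K}_N$ with $P(\{\omega:\omega_1=i_1,\dots,\omega_k=i_k\})=S_IS_I^*$ for every finite word $I=i_1\dots i_k$. Write $P(\omega)=P(\{\omega\})$. The representation is purely atomic if there is $\Omega\subset\mathcal{K}_N$ with $\oplus_{\omega\in\Omega}P(\omega)=I$; in that case the support of $P$ is $\{\omega\in\mathcal{K}_N:P(\omega)\neq0\}$.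 A word $\omega\in\mathcal{K}_N$ is periodic if $\sigma^k(\omega)=\sigma^{k'}(\omega)$ for some non-negative integers $k\neq k'$; it is cyclic (a cycle) if $\sigma^p(\omega)=\omega$ for some $p>0$. A subspace $M$ is cyclic for the representation if the closed linear span of $\{S_IS_J^*v:v\in M,\ I,J\text{ finite words}\}$ is $\mathcal{H}$. *)

theory Defs
  imports "HOL-Analysis.Analysis"
begin

section \<open>Complex Hilbert spaces\<close>

text \<open>
  The norm, metric and topology are those of the underlying real inner product \<open>Re \<langle>x, y\<rangle>\<close>;
  positive definiteness of \<open>cinner\<close> is inherited from it. \<open>cinner\<close> is linear in its first argument.
\<close>

class complex_inner = real_inner +
  fixes scaleC :: "complex \<Rightarrow> 'a \<Rightarrow> 'a" (infixr \<open>*\<^sub>C\<close> 75)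
    and cinner :: "'a \<Rightarrow> 'a \<Rightarrow> complex"
  assumes scaleC_add_right: "a *\<^sub>C (x + y) = a *\<^sub>C x + a *\<^sub>C y"
    and scaleC_add_left: "(a + b) *\<^sub>C x = a *\<^sub>C x + b *\<^sub>C x"
    and scaleC_scaleC: "a *\<^sub>C b *\<^sub>C x = (a * b) *\<^sub>C x"
    and scaleC_one: "1 *\<^sub>C x = x"
    and scaleR_scaleC: "r *\<^sub>R x = complex_of_real r *\<^sub>C x"
    and cinner_commute: "cinner x y = cnj (cinner y x)"
    and cinner_add_left: "cinner (x + y) z = cinner x z + cinner y z"
    and cinner_scaleC_left: "cinner (a *\<^sub>C x) y = a * cinner x y"
    and inner_eq_Re_cinner: "inner x y = Re (cinner x y)"

class complex_hilbert_space = complex_inner + complete_space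

instantiation complex :: complex_hilbert_space
begin

definition scaleC_complex :: "complex \<Rightarrow> complex \<Rightarrow> complex"
  where "scaleC_complex a x = a * x"

definition cinner_complex :: "complex \<Rightarrow> complex \<Rightarrow> complex"
  where "cinner_complex x y = x * cnj y"

instance
  by standard
    (simp_all add: scaleC_complex_def cinner_complex_def algebra_simps scaleR_conv_of_real
      inner_complex_def)

end

global_interpretation complex_vector: vector_space "scaleC :: complex \<Rightarrow> 'a \<Rightarrow> 'a :: complex_inner"
  by standard (rule scaleC_add_right scaleC_add_left scaleC_scaleC scaleC_one)+

definition cfinite_dimensional :: "'a :: complex_inner set \<Rightarrow> bool"
  where "cfinite_dimensional M \<longleftrightarrow> (\<exists>B. finite B \<and> complex_vector.span B = M)"

definition bounded_clinear :: "('a :: complex_inner \<Rightarrow> 'b :: complex_inner) \<Rightarrow> bool"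
  where "bounded_clinear T \<longleftrightarrow> bounded_linear T \<and> Vector_Spaces.linear scaleC scaleC T"

text \<open>
  Analogue of the library's \<^const>\<open>adjoint\<close> for the complex inner product. There is at most one such
  operator, and one exists for every bounded operator on a Hilbert space by the Riesz
  representation theorem.
\<close>

definition cadjoint :: "('a :: complex_inner \<Rightarrow> 'b :: complex_inner) \<Rightarrow> 'b \<Rightarrow> 'a"
  where "cadjoint T = (SOME T'. \<forall>x y. cinner (T x) y = cinner x (T' y))"

definition orthogonal_projection :: "('a :: complex_inner \<Rightarrow> 'a) \<Rightarrow> bool"
  where "orthogonal_projection T \<longleftrightarrow> bounded_clinear T \<and> T \<circ> T = T \<and> cadjoint T = T"


section \<open>Infinite words\<close>

text \<open>
  Letters are the naturals below \<open>N\<close>; the first letter of an infinite word is at index 0.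
\<close>

definition words :: "nat \<Rightarrow> (nat \<Rightarrow> nat) set"
  where "words N = {\<omega>. \<forall>n. \<omega> n < N}"

definition word_topology :: "nat \<Rightarrow> (nat \<Rightarrow> nat) topology"
  where "word_topology N = product_topology (\<lambda>_. discrete_topology {..<N}) UNIV"

lemma topspace_word_topology: "topspace (word_topology N) = words N"
  by (auto simp: word_topology_def words_def PiE_iff)

definition word_borel :: "nat \<Rightarrow> (nat \<Rightarrow> nat) measure"
  where "word_borel N = sigma (words N) {U. openin (word_topology N) U}"

definition cylinder :: "nat \<Rightarrow> nat list \<Rightarrow> (nat \<Rightarrow> nat) set"
  where "cylinder N I = {\<omega> \<in> words N. \<forall>k < length I. \<omega> k = I ! k}"

definition shift :: "(nat \<Rightarrow> nat) \<Rightarrow> nat \<Rightarrow> nat"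
  where "shift \<omega> = (\<lambda>n. \<omega> (Suc n))"

definition periodic_word :: "(nat \<Rightarrow> nat) \<Rightarrow> bool"
  where "periodic_word \<omega> \<longleftrightarrow> (\<exists>k k'. k \<noteq> k' \<and> (shift ^^ k) \<omega> = (shift ^^ k') \<omega>)"

definition cyclic_word :: "(nat \<Rightarrow> nat) \<Rightarrow> bool"
  where "cyclic_word \<omega> \<longleftrightarrow> (\<exists>p > 0. (shift ^^ p) \<omega> = \<omega>)"


section \<open>Representations of the Cuntz algebra\<close>

text \<open>Only the operators \<open>S i\<close> with \<open>i < N\<close> are relevant.\<close>

definition cuntz_representation :: "nat \<Rightarrow> (nat \<Rightarrow> 'h \<Rightarrow> 'h :: complex_hilbert_space) \<Rightarrow> bool"
  where "cuntz_representation N S \<longleftrightarrow>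
    (\<forall>i < N. bounded_clinear (S i)) \<and>
    (\<forall>i < N. \<forall>j < N. cadjoint (S i) \<circ> S j = (if i = j then id else (\<lambda>_. 0))) \<and>
    (\<forall>x. (\<Sum>i < N. S i (cadjoint (S i) x)) = x)"

definition word_operator :: "(nat \<Rightarrow> 'h \<Rightarrow> 'h) \<Rightarrow> nat list \<Rightarrow> 'h \<Rightarrow> 'h"
  where "word_operator S I = foldr (\<lambda>i T. S i \<circ> T) I id"

text \<open>Countable additivity is in the strong operator topology.\<close>

definition projection_valued_measure ::
    "'x measure \<Rightarrow> ('x set \<Rightarrow> 'h \<Rightarrow> 'h :: complex_hilbert_space) \<Rightarrow> bool"
  where "projection_valued_measure X P \<longleftrightarrow>
    (\<forall>A \<in> sets X. orthogonal_projection (P A)) \<and>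
    P {} = (\<lambda>_. 0) \<and> P (space X) = id \<and>
    (\<forall>A \<in> sets X. \<forall>B \<in> sets X. P (A \<inter> B) = P A \<circ> P B) \<and>
    (\<forall>F :: nat \<Rightarrow> 'x set. range F \<subseteq> sets X \<longrightarrow> disjoint_family F \<longrightarrow>
      (\<forall>x. (\<lambda>n. P (F n) x) sums P (\<Union>n. F n) x))"

text \<open>The values of \<open>P\<close> outside the Borel sets are left arbitrary.\<close>

definition associated_pvm ::
    "nat \<Rightarrow> (nat \<Rightarrow> 'h \<Rightarrow> 'h :: complex_hilbert_space) \<Rightarrow> ((nat \<Rightarrow> nat) set \<Rightarrow> 'h \<Rightarrow> 'h) \<Rightarrow> bool"
  where "associated_pvm N S P \<longleftrightarrow>
    projection_valued_measure (word_borel N) P \<and>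
    (\<forall>I \<in> lists {..<N}. P (cylinder N I) = word_operator S I \<circ> cadjoint (word_operator S I))"

text \<open>
  The orthogonal sum of projections over a possibly uncountable set converges unconditionally
  in the strong operator topology; the projections \<open>P {\<omega>}\<close> are mutually orthogonal for every
  projection valued measure.
\<close>

definition purely_atomic ::
    "nat \<Rightarrow> ((nat \<Rightarrow> nat) set \<Rightarrow> 'h \<Rightarrow> 'h :: complex_hilbert_space) \<Rightarrow> bool"
  where "purely_atomic N P \<longleftrightarrow> (\<exists>\<Omega> \<subseteq> words N. \<forall>x. ((\<lambda>\<omega>. P {\<omega>} x) has_sum x) \<Omega>)"

definition pvm_support ::
    "nat \<Rightarrow> ((nat \<Rightarrow> nat) set \<Rightarrow> 'h \<Rightarrow> 'h :: complex_hilbert_space) \<Rightarrow> (nat \<Rightarrow> nat) set"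
  where "pvm_support N P = {\<omega> \<in> words N. P {\<omega>} \<noteq> (\<lambda>_. 0)}"

definition cyclic_for ::
    "nat \<Rightarrow> (nat \<Rightarrow> 'h \<Rightarrow> 'h :: complex_hilbert_space) \<Rightarrow> 'h set \<Rightarrow> bool"
  where "cyclic_for N S M \<longleftrightarrow>
    closure (complex_vector.span
      {word_operator S I (cadjoint (word_operator S J) v) | I J v.
        I \<in> lists {..<N} \<and> J \<in> lists {..<N} \<and> v \<in> M}) = UNIV"

end

theory Submission
  imports Defs
begin

text \<open>
  Write \<open>Q\<^sub>\<omega> = P {\<omega>}\<close> and call it the atom at \<open>\<omega>\<close>. Let \<open>\<omega>|n\<close> be the prefix of length \<open>n\<close> of \<open>\<omega>\<close>,
  and let \<open>\<sigma>\<close> be the shift. The cylinders of the prefixes of \<open>\<omega>\<close> decrease to \<open>{\<omega>}\<close>, so \<open>Q\<^sub>\<omega>\<close> is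
  the strong limit of the projections
  \<open>S\<^sub>I S\<^sub>I\<^sup>*\<close> with \<open>I = \<omega>|n\<close> (\<open>atom_tendsto\<close>). This gives the covariance
  \<open>S\<^sub>I\<^sup>* Q\<^sub>\<omega> = Q\<^sub>\<omega>\<^sub>' S\<^sub>I\<^sup>*\<close> with \<open>\<omega>' = \<sigma>\<^sup>n \<omega>\<close> (\<open>W_adj_atom\<close>), and \<open>S\<^sub>I\<^sup>*\<close> is isometric on the range of
  \<open>Q\<^sub>\<omega>\<close>. Since \<open>M\<close> is invariant under the adjoints, cyclicity means that the vectors \<open>S\<^sub>I v\<close> with
  \<open>v \<in> M\<close> are total. The operator \<open>Q\<^sub>\<omega>\<close> kills them unless \<open>I\<close> is a prefix of \<open>\<omega>\<close>, so the range of
  \<open>Q\<^sub>\<omega>\<close> lies in every closed subspace that contains the vectors \<open>Q\<^sub>\<omega> S\<^sub>I v = S\<^sub>I Q\<^sub>\<omega>\<^sub>' v\<close>, where \<open>I\<close> runs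
  through the prefixes of \<open>\<omega>\<close> (\<open>range_atom_subset\<close>). Both claims then use that on the
  finite-dimensional space \<open>M\<close> strong convergence is uniform on bounded sets
  (\<open>tendsto_zero_uniform_on_span\<close>).

  If \<open>\<omega>\<close> is not periodic, neither is any \<open>\<omega>' = \<sigma>\<^sup>n \<omega>\<close>. For \<open>v \<in> M\<close> the vectors \<open>v\<^sub>k = S\<^sub>I\<^sup>* v\<close> with
  \<open>I = \<omega>'|k\<close> form a bounded sequence in \<open>M\<close>, and the norm of \<open>Q v\<^sub>k\<close>, where \<open>Q\<close> is the atom at
  \<open>\<sigma>\<^sup>k \<omega>'\<close>, equals the norm of \<open>Q\<^sub>\<omega>\<^sub>' v\<close> for every \<open>k\<close>. The atoms at these distinct points tend
  strongly, hence uniformly on bounded subsets of \<open>M\<close>, to zero. So \<open>Q\<^sub>\<omega>\<^sub>' v = 0\<close>, and \<open>Q\<^sub>\<omega> = 0\<close>.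

  If \<open>\<sigma>\<^sup>p \<omega> = \<omega>\<close> with \<open>p > 0\<close>, put \<open>L = Q\<^sub>\<omega> M\<close> and \<open>T\<^sub>k = S\<^sub>I\<^sup>*\<close> with \<open>I = \<omega>|(p k)\<close>. Each \<open>T\<^sub>k\<close> maps the
  finite-dimensional space \<open>L\<close> isometrically into itself, hence onto itself. A given \<open>y \<in> L\<close> is
  therefore \<open>T\<^sub>k Q\<^sub>\<omega> v\<^sub>k\<close> for a bounded sequence of vectors \<open>v\<^sub>k \<in> M\<close>. The operators
  \<open>T\<^sub>k (1 - Q\<^sub>\<omega>)\<close> tend to zero uniformly on bounded subsets of \<open>M\<close>, so \<open>y\<close> is the limit of the
  vectors \<open>T\<^sub>k v\<^sub>k\<close>, which lie in \<open>M\<close>. Thus \<open>L \<subseteq> M\<close>, and moving around the cycle shows that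
  \<open>Q\<^sub>\<omega> S\<^sub>I v \<in> L\<close> for all prefixes \<open>I\<close> of \<open>\<omega>\<close> and all \<open>v \<in> M\<close>.
\<close>

section \<open>Adjoints on a Hilbert space\<close>

text \<open>
  The functional \<open>q x = \<parallel>x\<parallel>\<^sup>2 - 2 f x\<close> is bounded below, and completeness yields a minimiser. The
  condition for a critical point of \<open>q\<close> at \<open>z\<close> is exactly \<open>f = inner z\<close>.
\<close>

theorem Riesz_representation:
  fixes f :: "'a :: {real_inner, complete_space} \<Rightarrow> real"
  assumes "bounded_linear f"
  obtains z where "\<And>x. f x = inner z x"
proof -
  interpret f: bounded_linear f by fact
  define q where "q x = (norm x)\<^sup>2 - 2 * f x" for x
  define m where "m = Inf (range q)"
  obtain K where K: "\<And>x. norm (f x) \<le> norm x * K"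
    using f.bounded by blast
  have "- K\<^sup>2 \<le> q x" for x
  proof -
    have "0 \<le> (norm x - K)\<^sup>2" by simp
    then show ?thesis
      using K[of x] by (simp add: q_def power2_eq_square algebra_simps)
  qed
  then have bdd: "bdd_below (range q)" by (meson bdd_below.I2)
  have m_le: "m \<le> q x" for x
    unfolding m_def by (rule cInf_lower[OF _ bdd]) simp
  have "\<exists>x. q x < m + inverse (real (Suc n))" for n
  proof -
    have "Inf (range q) < m + inverse (real (Suc n))" by (simp add: m_def)
    then show ?thesis using cInf_less_iff[OF _ bdd] by auto
  qed
  then obtain X where X: "\<And>n. q (X n) < m + inverse (real (Suc n))" by metis
  \<comment> \<open>By the parallelogram law a minimising sequence is Cauchy.\<close>
  have dist_X: "(norm (x - y))\<^sup>2 \<le> 2 * (q x - m) + 2 * (q y - m)" for x y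
  proof -
    have "(norm (x - y))\<^sup>2 = 2 * q x + 2 * q y - 4 * q ((1/2) *\<^sub>R (x + y))"
      by (simp add: q_def f.scaleR f.add power2_norm_eq_inner algebra_simps inner_commute)
    then show ?thesis using m_le[of "(1/2) *\<^sub>R (x + y)"] by simp
  qed
  have "Cauchy X"
  proof (rule metric_CauchyI)
    fix e :: real assume "e > 0"
    then have "e\<^sup>2 / 4 > 0" by simp
    then obtain n0 where n0: "inverse (real (Suc n0)) < e\<^sup>2 / 4"
      using reals_Archimedean by blast
    have small: "q (X n) - m < e\<^sup>2 / 4" if "n \<ge> n0" for n
    proof -
      have "inverse (real (Suc n)) \<le> inverse (real (Suc n0))"
        using that by (simp add: field_simps)
      then show ?thesis using X[of n] n0 by linarith
    qed
    have "dist (X a) (X b) < e" if "a \<ge> n0" "b \<ge> n0" for a b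
    proof -
      have "(norm (X a - X b))\<^sup>2 < e\<^sup>2"
        using dist_X[of "X a" "X b"] small[OF that(1)] small[OF that(2)] by simp
      then show ?thesis
        using \<open>e > 0\<close> by (simp add: dist_norm power2_less_imp_less)
    qed
    then show "\<exists>M. \<forall>a\<ge>M. \<forall>b\<ge>M. dist (X a) (X b) < e" by blast
  qed
  then obtain z where z: "X \<longlonglongrightarrow> z"
    using Cauchy_convergent_iff convergent_def by blast
  have "(\<lambda>n. q (X n)) \<longlonglongrightarrow> q z"
    unfolding q_def by (intro tendsto_intros f.tendsto z)
  moreover have "(\<lambda>n. m + inverse (real (Suc n))) \<longlonglongrightarrow> m + 0"
    by (intro tendsto_intros LIMSEQ_inverse_real_of_nat)
  ultimately have q_z: "q z \<le> m"
    using X by (intro LIMSEQ_le[of "\<lambda>n. q (X n)" _ "\<lambda>n. m + inverse (real (Suc n))"])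
      (auto intro: less_imp_le)
  have "f h = inner z h" for h
  proof -
    define d where "d = f h - inner z h"
    \<comment> \<open>The first variation of the functional at its minimum vanishes.\<close>
    have variation: "2 * t * d \<le> t\<^sup>2 * (norm h)\<^sup>2" for t
    proof -
      have "q (z + t *\<^sub>R h) = q z + t\<^sup>2 * (norm h)\<^sup>2 - 2 * t * d"
        by (simp add: q_def d_def f.scaleR f.add power2_norm_eq_inner algebra_simps
            inner_commute power2_eq_square[of t])
      then show ?thesis using m_le[of "z + t *\<^sub>R h"] q_z by simp
    qed
    define s where "s = (norm h)\<^sup>2 + 1"
    have "s > 0" by (simp add: s_def add_nonneg_pos)
    have "2 * d\<^sup>2 / s \<le> d\<^sup>2 * (norm h)\<^sup>2 / s\<^sup>2"
      using variation[of "d / s"] by (simp add: power2_eq_square)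
    then have "2 * d\<^sup>2 * s \<le> d\<^sup>2 * (norm h)\<^sup>2"
      using \<open>s > 0\<close> by (simp add: field_simps power2_eq_square)
    then have "d\<^sup>2 * ((norm h)\<^sup>2 + 2) \<le> 0" by (simp add: s_def algebra_simps)
    then have "d\<^sup>2 \<le> 0"
      by (metis add_nonneg_pos mult_le_0_iff not_le zero_le_power2 zero_less_numeral)
    then show ?thesis by (simp add: d_def)
  qed
  then show thesis using that by blast
qed

lemma Im_cinner: "Im (cinner x y) = inner (scaleC (- \<i>) x) y"
  unfolding inner_eq_Re_cinner cinner_scaleC_left by simp

text \<open>
  The choice in the definition of \<^const>\<open>cadjoint\<close> is meaningful only once some adjoint is known to
  exist. The Riesz theorem provides one for the real inner product; as \<open>T\<close> commutes with
  multiplication by \<open>\<i>\<close>, the same operator is adjoint for the complex inner product.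
\<close>

lemma cadjoint_inner:
  fixes T :: "'a :: complex_hilbert_space \<Rightarrow> 'b :: complex_inner"
  assumes "bounded_clinear T"
  shows "inner (T x) y = inner x (cadjoint T y)"
proof -
  interpret T: bounded_linear T
    using assms by (simp add: bounded_clinear_def)
  have scale: "T (scaleC a x) = scaleC a (T x)" for a x
    using assms by (simp add: bounded_clinear_def Vector_Spaces.linear_iff)
  have "\<exists>z. \<forall>x. inner (T x) y = inner x z" for y
  proof -
    have "bounded_linear (\<lambda>x. inner (T x) y)"
      using T.bounded_linear_axioms bounded_linear_compose bounded_linear_inner_left by blast
    then obtain z where "\<And>x. inner (T x) y = inner z x"
      using Riesz_representation by blast
    then show ?thesis by (auto simp: inner_commute)
  qed
  then obtain T' where T': "\<And>x y. inner (T x) y = inner x (T' y)" by metis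
  have "\<forall>x y. cinner (T x) y = cinner x (T' y)"
    by (simp add: complex_eq_iff Im_cinner flip: inner_eq_Re_cinner scale T')
  then have "\<forall>x y. cinner (T x) y = cinner x (cadjoint T y)"
    unfolding cadjoint_def by (rule someI[of "\<lambda>T'. \<forall>x y. cinner (T x) y = cinner x (T' y)"])
  then show ?thesis by (simp add: inner_eq_Re_cinner)
qed

lemma cadjoint_eqI:
  fixes T :: "'a :: complex_hilbert_space \<Rightarrow> 'b :: complex_inner"
  assumes "bounded_clinear T" and "\<And>x y. inner (T x) y = inner x (T' y)"
  shows "cadjoint T = T'"
proof
  fix y
  have "inner x (cadjoint T y - T' y) = 0" for x
    using cadjoint_inner[OF assms(1), of x y] assms(2)[of x y] by (simp add: inner_diff_right)
  then show "cadjoint T y = T' y" by (metis inner_eq_zero_iff right_minus_eq)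
qed

lemma bounded_linear_cadjoint:
  fixes T :: "'a :: complex_hilbert_space \<Rightarrow> 'b :: complex_inner"
  assumes "bounded_clinear T"
  shows "bounded_linear (cadjoint T)"
proof -
  have adj: "inner x (cadjoint T y) = inner (T x) y" for x y
    by (rule cadjoint_inner[OF assms, symmetric])
  have T: "bounded_linear T" using assms by (simp add: bounded_clinear_def)
  have eqI: "u = v" if "\<And>x. inner x u = inner x v" for u v :: 'a
    by (metis that inner_diff_right inner_eq_zero_iff right_minus_eq)
  obtain K where K: "K \<ge> 0" "\<And>x. norm (T x) \<le> norm x * K"
    using bounded_linear.nonneg_bounded[OF T] by blast
  have "norm (cadjoint T y) \<le> norm y * K" for y
  proof (cases "cadjoint T y = 0")
    case False
    have "(norm (cadjoint T y))\<^sup>2 \<le> norm (T (cadjoint T y)) * norm y"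
      by (simp add: power2_norm_eq_inner adj norm_cauchy_schwarz)
    also have "\<dots> \<le> norm (cadjoint T y) * (norm y * K)"
      using K(2)[of "cadjoint T y"] by (metis mult.assoc mult.commute mult_right_mono norm_ge_zero)
    finally show ?thesis using False by (simp add: power2_eq_square)
  qed (simp add: K(1))
  then show ?thesis
    by (intro bounded_linear_intro[where K = K] eqI)
      (simp_all add: adj inner_add_right)
qed

section \<open>Finite-dimensional subspaces\<close>

lemma orthogonal_expansion:
  fixes C :: "'a :: real_inner set"
  assumes "finite C" "pairwise orthogonal C" "v \<in> span C"
  shows "(\<Sum>c\<in>C. (inner v c / inner c c) *\<^sub>R c) = v"
  using assms(3)
proof (induction rule: span_induct)
  case base
  have "(\<Sum>c\<in>C. (r * inner x c / inner c c) *\<^sub>R c) = r *\<^sub>R (\<Sum>c\<in>C. (inner x c / inner c c) *\<^sub>R c)"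
    for r x
    by (simp add: scaleR_sum_right)
  then show ?case
    by (auto simp: subspace_def inner_add_left add_divide_distrib scaleR_add_left sum.distrib)
next
  case (step b)
  have "(\<Sum>c\<in>C. (inner b c / inner c c) *\<^sub>R c) = (\<Sum>c\<in>C. if c = b then b else 0)"
    using assms(2) step by (intro sum.cong) (auto simp: pairwise_def orthogonal_def)
  then show ?case using assms(1) step by simp
qed

text \<open>
  The span is the fixed-point set of the orthogonal projection onto it, and an orthogonal spanning
  set gives a formula for this projection that shows its continuity.
\<close>

lemma closed_span_finite:
  fixes B :: "'a :: real_inner set"
  assumes "finite B"
  shows "closed (span B)"
proof -
  obtain C where C: "finite C" "span C = span B" "pairwise orthogonal C"
    using basis_orthogonal[OF assms] by blast
  have "span C = {v. (\<Sum>c\<in>C. (inner v c / inner c c) *\<^sub>R c) = v}"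
  proof (intro equalityI subsetI CollectI)
    fix v assume "v \<in> {v. (\<Sum>c\<in>C. (inner v c / inner c c) *\<^sub>R c) = v}"
    moreover have "(\<Sum>c\<in>C. (inner v c / inner c c) *\<^sub>R c) \<in> span C"
      by (intro span_sum span_scale span_base)
    ultimately show "v \<in> span C" by simp
  qed (rule orthogonal_expansion[OF C(1,3)])
  moreover have "closed \<dots>"
    unfolding divide_inverse by (intro closed_Collect_eq continuous_intros)
  ultimately show ?thesis using C(2) by simp
qed

text \<open>
  On a finite-dimensional space pointwise convergence of linear maps is uniform on bounded sets,
  since the coordinates of the arguments with respect to an orthogonal spanning set stay bounded.
\<close>

lemma tendsto_zero_uniform_on_span:
  fixes A :: "nat \<Rightarrow> 'a :: real_inner \<Rightarrow> 'b :: real_normed_vector"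
  assumes "finite B"
    and lin: "\<And>k. linear (A k)"
    and lim: "\<And>x. x \<in> span B \<Longrightarrow> (\<lambda>k. A k x) \<longlonglongrightarrow> 0"
    and v: "\<And>k. v k \<in> span B" "\<And>k. norm (v k) \<le> K"
  shows "(\<lambda>k. A k (v k)) \<longlonglongrightarrow> 0"
proof -
  obtain C where C: "finite C" "span C = span B" "pairwise orthogonal C"
    using basis_orthogonal[OF assms(1)] by blast
  have coef: "\<bar>inner (v k) c / inner c c\<bar> \<le> K / norm c" for k c
  proof (cases "c = 0")
    case False
    have "\<bar>inner (v k) c\<bar> \<le> K * norm c"
      using Cauchy_Schwarz_ineq2[of "v k" c] v(2)[of k] mult_right_mono[of "norm (v k)" K "norm c"]
      by simp
    then show ?thesis
      using False by (simp add: field_simps flip: power2_norm_eq_inner) (simp add: power2_eq_square)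
  qed simp
  have "A k (v k) = (\<Sum>c\<in>C. (inner (v k) c / inner c c) *\<^sub>R A k c)" for k
  proof -
    have "A k (v k) = A k (\<Sum>c\<in>C. (inner (v k) c / inner c c) *\<^sub>R c)"
      using orthogonal_expansion[OF C(1,3)] v(1) C(2) by simp
    also have "\<dots> = (\<Sum>c\<in>C. (inner (v k) c / inner c c) *\<^sub>R A k c)"
      by (simp add: linear_sum[OF lin] linear_scale[OF lin])
    finally show ?thesis .
  qed
  moreover have "(\<lambda>k. (inner (v k) c / inner c c) *\<^sub>R A k c) \<longlonglongrightarrow> 0" if "c \<in> C" for c
  proof (rule Lim_null_comparison)
    show "\<forall>\<^sub>F k in sequentially.
        norm ((inner (v k) c / inner c c) *\<^sub>R A k c) \<le> (K / norm c) * norm (A k c)"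
      unfolding norm_scaleR by (intro always_eventually allI mult_right_mono coef) simp
    have "c \<in> span B" using that C(2) span_base by blast
    then show "(\<lambda>k. (K / norm c) * norm (A k c)) \<longlonglongrightarrow> 0"
      by (intro tendsto_mult_right_zero tendsto_norm_zero lim)
  qed
  then have "(\<lambda>k. \<Sum>c\<in>C. (inner (v k) c / inner c c) *\<^sub>R A k c) \<longlonglongrightarrow> 0"
    by (rule tendsto_null_sum)
  ultimately show ?thesis by simp
qed

text \<open>
  The image of a basis is independent and has as many elements as the basis; a vector outside its
  span could be adjoined to give an independent set that is too large.
\<close>

lemma linear_inj_on_span_surj:
  fixes f :: "'a :: real_vector \<Rightarrow> 'a"
  assumes "linear f" "finite B" "f ` span B \<subseteq> span B" "inj_on f (span B)"
  shows "f ` span B = span B"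
proof -
  obtain C where C: "C \<subseteq> B" "independent C" "span C = span B"
    by (metis maximal_independent_subset span_mono span_span span_superset subset_antisym)
  then have "finite C" using assms(2) finite_subset by blast
  have ind: "independent (f ` C)"
    using linear_independent_injective_image[OF assms(1) C(2)] assms(4) C(3) by simp
  have card: "card (f ` C) = card C"
    using assms(4) C(3) span_superset by (metis card_image inj_on_subset)
  have "y \<in> span (f ` C)" if "y \<in> span B" for y
  proof (rule ccontr)
    assume y: "y \<notin> span (f ` C)"
    then have "independent (insert y (f ` C))"
      using ind by (simp add: independent_insert)
    moreover have "insert y (f ` C) \<subseteq> span C"
      using that assms(3) C(3) span_superset by fastforce
    ultimately have "card (insert y (f ` C)) \<le> card C"
      using independent_span_bound[OF \<open>finite C\<close>] by blast
    moreover have "y \<notin> f ` C" using y span_base[of y "f ` C"] by blast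
    ultimately show False using card \<open>finite C\<close> by simp
  qed
  moreover have "span (f ` C) = f ` span B"
    using linear_span_image[OF assms(1), of C] C(3) by simp
  ultimately show ?thesis using assms(3) by blast
qed

text \<open>
  This makes a complex finite-dimensional subspace accessible to the real orthogonalisation and
  dimension arguments above.
\<close>

lemma complex_span_conv_real_span:
  "complex_vector.span B = span (B \<union> scaleC \<i> ` B)"
proof
  have cs: "complex_vector.subspace (span (B \<union> scaleC \<i> ` B))"
  proof (unfold complex_vector.subspace_def, intro conjI ballI allI)
    fix c x assume x: "x \<in> span (B \<union> scaleC \<i> ` B)"
    have "scaleC \<i> x \<in> span (B \<union> scaleC \<i> ` B)"
      using x
    proof (induction rule: span_induct)
      case base
      have "scaleC \<i> (r *\<^sub>R x) = r *\<^sub>R scaleC \<i> x" for r and x :: 'a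
        unfolding scaleR_scaleC scaleC_scaleC by (simp add: mult.commute)
      then show ?case
        by (auto simp: subspace_def scaleC_add_right span_add span_scale intro: span_zero)
    next
      case (step x)
      then show ?case
      proof
        assume "x \<in> scaleC \<i> ` B"
        then obtain b where b: "b \<in> B" "x = scaleC \<i> b" by blast
        have "scaleC \<i> x = (- 1) *\<^sub>R b"
          unfolding b(2) scaleR_scaleC scaleC_scaleC by simp
        also have "\<dots> \<in> span (B \<union> scaleC \<i> ` B)"
          using b(1) by (intro span_scale span_base) simp
        finally show ?case .
      qed (auto intro: span_base)
    qed
    moreover have "scaleC c x = Re c *\<^sub>R x + Im c *\<^sub>R scaleC \<i> x"
      unfolding scaleR_scaleC scaleC_scaleC scaleC_add_left[symmetric]
      by (metis complex_eq mult.commute)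
    ultimately show "scaleC c x \<in> span (B \<union> scaleC \<i> ` B)"
      using x by (simp add: span_add span_scale)
  qed (auto intro: span_zero span_add)
  show "complex_vector.span B \<subseteq> span (B \<union> scaleC \<i> ` B)"
    by (rule complex_vector.span_minimal[OF _ cs]) (auto intro: span_base)
  have "subspace (complex_vector.span B)"
    unfolding subspace_def scaleR_scaleC
    by (auto intro: complex_vector.span_zero complex_vector.span_add complex_vector.span_scale)
  then show "span (B \<union> scaleC \<i> ` B) \<subseteq> complex_vector.span B"
    by (intro span_minimal) (auto intro: complex_vector.span_base complex_vector.span_scale)
qed


section \<open>Projection valued measures\<close>

lemma projection_valued_measureD:
  assumes "projection_valued_measure X P"
  shows "\<And>A. A \<in> sets X \<Longrightarrow> bounded_clinear (P A)"
    and "P {} = (\<lambda>_. 0)" "P (space X) = id"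
    and "\<And>A B x. A \<in> sets X \<Longrightarrow> B \<in> sets X \<Longrightarrow> P A (P B x) = P (A \<inter> B) x"
    and "\<And>F x. range F \<subseteq> sets X \<Longrightarrow> disjoint_family F \<Longrightarrow> (\<lambda>n::nat. P (F n) x) sums P (\<Union>n. F n) x"
  using assms by (auto simp: projection_valued_measure_def orthogonal_projection_def)

lemma projection_valued_measure_Un:
  assumes pvm: "projection_valued_measure X P"
    and "A \<in> sets X" "B \<in> sets X" "A \<inter> B = {}"
  shows "P (A \<union> B) x = P A x + P B x"
proof -
  have "(\<lambda>n. P (binaryset A B n) x) sums P (\<Union>n. binaryset A B n) x"
    using assms(2-4)
    by (intro projection_valued_measureD(5)[OF pvm])
      (auto simp: range_binaryset_eq disjoint_family_on_def binaryset_def)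
  moreover have "(\<lambda>n. P (binaryset A B n) x) sums (P A x + P B x)"
    using binaryset_sums[of "\<lambda>A. P A x" A B] projection_valued_measureD(2)[OF pvm] by simp
  ultimately show ?thesis
    using sums_unique2 by (metis UN_binaryset_eq)
qed

lemma projection_valued_measure_incseq:
  assumes pvm: "projection_valued_measure X P"
    and F: "range F \<subseteq> sets X" "incseq F"
  shows "(\<lambda>n. P (F n) x) \<longlonglongrightarrow> P (\<Union>n. F n) x"
proof -
  have D: "range (disjointed F) \<subseteq> sets X"
    using sets.range_disjointed_sets F(1) by blast
  have "(\<Sum>i\<le>n. P (disjointed F i) x) = P (F n) x" for n
  proof (induction n)
    case 0
    then show ?case by simp
  next
    case (Suc n)
    have "disjointed F (Suc n) = F (Suc n) - F n"
      by (rule disjointed_mono[OF F(2)])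
    moreover have "F n \<union> (F (Suc n) - F n) = F (Suc n)"
      using incseqD[OF F(2), of n "Suc n"] by auto
    moreover have "P (F n \<union> disjointed F (Suc n)) x = P (F n) x + P (disjointed F (Suc n)) x"
      using F(1) D by (intro projection_valued_measure_Un[OF pvm]) (auto simp: calculation(1))
    ultimately show ?case using Suc by simp
  qed
  moreover have "(\<lambda>n. P (disjointed F n) x) sums P (\<Union>n. F n) x"
    using projection_valued_measureD(5)[OF pvm D disjoint_family_disjointed]
    by (simp add: UN_disjointed_eq)
  ultimately show ?thesis by (simp add: sums_def_le)
qed

text \<open>
  Continuity from above follows from continuity from below by passing to complements; the total
  mass is the identity.
\<close>

lemma projection_valued_measure_decseq:
  assumes pvm: "projection_valued_measure X P"
    and F: "range F \<subseteq> sets X" "decseq F"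
  shows "(\<lambda>n. P (F n) x) \<longlonglongrightarrow> P (\<Inter>n. F n) x"
proof -
  have compl: "P A x = x - P (space X - A) x" if "A \<in> sets X" for A
    using projection_valued_measure_Un[OF pvm that, of "space X - A" x] that
      projection_valued_measureD(3)[OF pvm] sets.sets_into_space[OF that]
    by (simp add: Un_absorb1 eq_diff_eq)
  have "(\<lambda>n. P (space X - F n) x) \<longlonglongrightarrow> P (\<Union>n. space X - F n) x"
    using F by (intro projection_valued_measure_incseq[OF pvm]) (fastforce simp: decseq_def mono_def)+
  then have "(\<lambda>n. x - P (space X - F n) x) \<longlonglongrightarrow> x - P (\<Union>n. space X - F n) x"
    by (intro tendsto_intros)
  moreover have "(\<Union>n. space X - F n) = space X - (\<Inter>n. F n)" by auto
  moreover have "(\<Inter>n. F n) \<in> sets X" using F(1) by (intro sets.countable_INT) auto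
  ultimately show ?thesis using F(1) by (simp add: range_subsetD flip: compl)
qed


section \<open>Cylinders in the space of infinite words\<close>

lemma sets_word_borel:
  "sets (word_borel N) = sigma_sets (words N) {U. openin (word_topology N) U}"
proof -
  have "{U. openin (word_topology N) U} \<subseteq> Pow (words N)"
    using openin_subset topspace_word_topology by fastforce
  then show ?thesis by (simp add: word_borel_def)
qed

lemma openin_cylinder:
  assumes "I \<in> lists {..<N}"
  shows "openin (word_topology N) (cylinder N I)"
proof -
  have "openin (word_topology N) {\<omega> \<in> topspace (word_topology N). \<omega> k \<in> {I ! k}}"
    if "k < length I" for k
  proof (rule openin_continuous_map_preimage)
    show "continuous_map (word_topology N) (discrete_topology {..<N}) (\<lambda>\<omega>. \<omega> k)"
      unfolding word_topology_def by (rule continuous_map_product_projection) simp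
    show "openin (discrete_topology {..<N}) {I ! k}"
      using assms that by (auto simp: in_lists_conv_set)
  qed
  then have "openin (word_topology N) (topspace (word_topology N) \<inter>
      (\<Inter>k<length I. {\<omega> \<in> topspace (word_topology N). \<omega> k \<in> {I ! k}}))"
    by (cases "I = []") (auto intro!: openin_Int openin_INT simp del: singleton_iff)
  also have "topspace (word_topology N) \<inter>
      (\<Inter>k<length I. {\<omega> \<in> topspace (word_topology N). \<omega> k \<in> {I ! k}}) = cylinder N I"
    by (auto simp: cylinder_def topspace_word_topology)
  finally show ?thesis .
qed

lemma cylinder_in_sets:
  assumes "I \<in> lists {..<N}"
  shows "cylinder N I \<in> sets (word_borel N)"
  using openin_cylinder[OF assms] by (simp add: sets_word_borel sigma_sets.Basic)

definition prefix :: "(nat \<Rightarrow> nat) \<Rightarrow> nat \<Rightarrow> nat list"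
  where "prefix \<omega> n = map \<omega> [0..<n]"

lemma prefix_in_lists: "\<omega> \<in> words N \<Longrightarrow> prefix \<omega> n \<in> lists {..<N}"
  by (auto simp: prefix_def words_def)

lemma funpow_shift: "(shift ^^ n) \<omega> = (\<lambda>k. \<omega> (n + k))"
  by (induction n) (auto simp: shift_def)

lemma shift_in_words: "\<omega> \<in> words N \<Longrightarrow> (shift ^^ n) \<omega> \<in> words N"
  by (simp add: funpow_shift words_def)

lemma prefix_add: "prefix \<omega> (n + m) = prefix \<omega> n @ prefix ((shift ^^ n) \<omega>) m"
  by (rule nth_equalityI) (auto simp: prefix_def funpow_shift nth_append)

lemma decseq_cylinder_prefix: "decseq (\<lambda>n. cylinder N (prefix \<omega> n))"
  by (auto simp: decseq_def cylinder_def prefix_def)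

lemma INT_cylinder_prefix:
  assumes "\<omega> \<in> words N"
  shows "(\<Inter>n. cylinder N (prefix \<omega> n)) = {\<omega>}"
proof -
  have "\<omega>' = \<omega>" if "\<omega>' \<in> (\<Inter>n. cylinder N (prefix \<omega> n))" for \<omega>'
  proof
    fix k
    have "\<omega>' \<in> cylinder N (prefix \<omega> (Suc k))" using that by blast
    then show "\<omega>' k = \<omega> k" by (auto simp: cylinder_def prefix_def simp del: upt_Suc)
  qed
  then show ?thesis using assms by (auto simp: cylinder_def prefix_def)
qed

lemma singleton_in_sets:
  assumes "\<omega> \<in> words N"
  shows "{\<omega>} \<in> sets (word_borel N)"
proof -
  have "(\<Inter>n. cylinder N (prefix \<omega> n)) \<in> sets (word_borel N)"
    by (intro sets.countable_INT image_subsetI cylinder_in_sets prefix_in_lists assms) simp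
  then show ?thesis by (simp add: INT_cylinder_prefix[OF assms])
qed


section \<open>Word operators and atoms\<close>

locale cuntz_pvm =
  fixes N :: nat
    and S :: "nat \<Rightarrow> 'h \<Rightarrow> 'h :: complex_hilbert_space"
    and P :: "(nat \<Rightarrow> nat) set \<Rightarrow> 'h \<Rightarrow> 'h"
  assumes representation: "cuntz_representation N S"
    and associated: "associated_pvm N S P"
begin

lemma pvm: "projection_valued_measure (word_borel N) P"
  using associated by (simp add: associated_pvm_def)

abbreviation W :: "nat list \<Rightarrow> 'h \<Rightarrow> 'h"
  where "W I \<equiv> word_operator S I"

abbreviation W_adj :: "nat list \<Rightarrow> 'h \<Rightarrow> 'h"
  where "W_adj I \<equiv> cadjoint (word_operator S I)"

abbreviation atom :: "(nat \<Rightarrow> nat) \<Rightarrow> 'h \<Rightarrow> 'h"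
  where "atom \<omega> \<equiv> P {\<omega>}"

lemma W_Nil: "W [] = id" and W_Cons: "W (i # I) = S i \<circ> W I"
  by (simp_all add: word_operator_def)

lemma W_append: "W (I @ J) x = W I (W J x)"
  by (induction I) (simp_all add: W_Nil W_Cons)

lemma bounded_clinear_W: "I \<in> lists {..<N} \<Longrightarrow> bounded_clinear (W I)"
proof (induction I)
  case Nil
  then show ?case
    by (simp add: W_Nil bounded_clinear_def Vector_Spaces.linear_iff complex_vector.vector_space_axioms
        bounded_linear_ident id_def)
next
  case (Cons i I)
  then have "bounded_clinear (S i)" "bounded_clinear (W I)"
    using representation by (auto simp: cuntz_representation_def)
  then show ?case
    by (simp add: W_Cons bounded_clinear_def Vector_Spaces.linear_iff bounded_linear_compose comp_def)
qed

lemma bounded_linear_W: "I \<in> lists {..<N} \<Longrightarrow> bounded_linear (W I)"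
  using bounded_clinear_W by (simp add: bounded_clinear_def)

lemma bounded_linear_W_adj: "I \<in> lists {..<N} \<Longrightarrow> bounded_linear (W_adj I)"
  by (rule bounded_linear_cadjoint[OF bounded_clinear_W])

lemma inner_W: "I \<in> lists {..<N} \<Longrightarrow> inner (W I x) y = inner x (W_adj I y)"
  by (rule cadjoint_inner[OF bounded_clinear_W])

lemma W_adj_append:
  assumes "I \<in> lists {..<N}" "J \<in> lists {..<N}"
  shows "W_adj (I @ J) y = W_adj J (W_adj I y)"
proof -
  have "W_adj (I @ J) = W_adj J \<circ> W_adj I"
    using assms by (intro cadjoint_eqI bounded_clinear_W) (simp_all add: W_append inner_W)
  then show ?thesis by simp
qed

lemma W_adj_Nil: "W_adj [] = id"
  using bounded_clinear_W[of "[]"] by (intro cadjoint_eqI) (simp_all add: W_Nil)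

lemma W_adj_single: "i < N \<Longrightarrow> W_adj [i] = cadjoint (S i)"
  by (simp add: W_Cons W_Nil)

lemma W_adj_W: "I \<in> lists {..<N} \<Longrightarrow> W_adj I (W I x) = x"
proof (induction I arbitrary: x)
  case Nil
  show ?case unfolding W_adj_Nil by (simp add: W_Nil)
next
  case (Cons i I)
  then have i: "i < N" "[i] \<in> lists {..<N}" "I \<in> lists {..<N}" by auto
  have "cadjoint (S i) \<circ> S i = id"
    using representation i(1) by (simp add: cuntz_representation_def)
  then have "cadjoint (S i) (S i x) = x" for x by (metis comp_apply id_apply)
  then have "cadjoint (S i) (W (i # I) x) = W I x"
    by (simp add: W_Cons)
  moreover have "W_adj (i # I) (W (i # I) x) = W_adj I (cadjoint (S i) (W (i # I) x))"
    using W_adj_append[OF i(2,3)] W_adj_single[OF i(1)] by simp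
  ultimately show ?case
    using Cons.IH[OF i(3)] by (simp only:)
qed

lemma norm_W: "I \<in> lists {..<N} \<Longrightarrow> norm (W I x) = norm x"
  by (simp add: norm_eq_sqrt_inner inner_W W_adj_W)

lemma norm_W_adj_le:
  assumes "I \<in> lists {..<N}"
  shows "norm (W_adj I x) \<le> norm x"
proof (cases "W_adj I x = 0")
  case False
  have "norm (W_adj I x) * norm (W_adj I x) = inner (W I (W_adj I x)) x"
    using assms by (simp add: inner_W flip: power2_norm_eq_inner power2_eq_square)
  also have "\<dots> \<le> norm (W_adj I x) * norm x"
    using norm_cauchy_schwarz[of "W I (W_adj I x)" x] norm_W[OF assms] by simp
  finally show ?thesis using False by simp
qed simp

lemma P_cylinder: "I \<in> lists {..<N} \<Longrightarrow> P (cylinder N I) x = W I (W_adj I x)"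
  using associated by (simp add: associated_pvm_def)

lemma bounded_linear_atom: "\<omega> \<in> words N \<Longrightarrow> bounded_linear (atom \<omega>)"
  using projection_valued_measureD(1)[OF pvm singleton_in_sets]
  by (simp add: bounded_clinear_def)

lemma linear_atom: "\<omega> \<in> words N \<Longrightarrow> linear (atom \<omega>)"
  using bounded_linear.linear bounded_linear_atom by blast

lemma atom_atom: "\<omega> \<in> words N \<Longrightarrow> atom \<omega> (atom \<omega> x) = atom \<omega> x"
  using projection_valued_measureD(4)[OF pvm] by (simp add: singleton_in_sets)

lemma atom_tendsto:
  assumes "\<omega> \<in> words N"
  shows "(\<lambda>n. W (prefix \<omega> n) (W_adj (prefix \<omega> n) x)) \<longlonglongrightarrow> atom \<omega> x"
proof -
  have "(\<lambda>n. P (cylinder N (prefix \<omega> n)) x) \<longlonglongrightarrow> P (\<Inter>n. cylinder N (prefix \<omega> n)) x"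
    by (intro projection_valued_measure_decseq[OF pvm] decseq_cylinder_prefix image_subsetI
        cylinder_in_sets prefix_in_lists assms)
  then show ?thesis
    using assms by (simp add: INT_cylinder_prefix P_cylinder prefix_in_lists)
qed

text \<open>
  The operator on the left is the projection of a cylinder that contains \<open>\<omega>\<close>.
\<close>

lemma W_W_adj_atom:
  assumes "\<omega> \<in> words N"
  shows "W (prefix \<omega> n) (W_adj (prefix \<omega> n) (atom \<omega> x)) = atom \<omega> x"
proof -
  have "\<omega> \<in> cylinder N (prefix \<omega> n)"
    using INT_cylinder_prefix[OF assms] by blast
  then have "P (cylinder N (prefix \<omega> n)) (atom \<omega> x) = atom \<omega> x"
    using assms
    by (simp add: projection_valued_measureD(4)[OF pvm] singleton_in_sets cylinder_in_sets
        prefix_in_lists)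
  then show ?thesis using assms by (simp add: P_cylinder prefix_in_lists)
qed

lemma norm_W_adj_atom:
  assumes "\<omega> \<in> words N"
  shows "norm (W_adj (prefix \<omega> n) (atom \<omega> x)) = norm (atom \<omega> x)"
  using norm_W[OF prefix_in_lists[OF assms]] W_W_adj_atom[OF assms] by metis

text \<open>
  For prefixes longer than \<open>n\<close>, applying the adjoint of the prefix of length \<open>n\<close> to the cylinder
  projection cancels the first \<open>n\<close> letters and leaves the cylinder projection of the shifted word,
  applied after that adjoint. The equation is the limit of these identities.
\<close>

lemma W_adj_atom:
  assumes "\<omega> \<in> words N"
  shows "W_adj (prefix \<omega> n) (atom \<omega> x) = atom ((shift ^^ n) \<omega>) (W_adj (prefix \<omega> n) x)"
proof (rule LIMSEQ_unique)
  let ?\<omega>' = "(shift ^^ n) \<omega>"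
  have lists: "prefix \<omega> n \<in> lists {..<N}" "prefix ?\<omega>' m \<in> lists {..<N}" for m
    using assms by (simp_all only: prefix_in_lists shift_in_words)
  show "(\<lambda>m. W (prefix ?\<omega>' m) (W_adj (prefix ?\<omega>' m) (W_adj (prefix \<omega> n) x)))
      \<longlonglongrightarrow> atom ?\<omega>' (W_adj (prefix \<omega> n) x)"
    by (rule atom_tendsto[OF shift_in_words[OF assms]])
  have "(\<lambda>m. W_adj (prefix \<omega> n) (W (prefix \<omega> (m + n)) (W_adj (prefix \<omega> (m + n)) x)))
      \<longlonglongrightarrow> W_adj (prefix \<omega> n) (atom \<omega> x)"
    by (intro bounded_linear.tendsto[OF bounded_linear_W_adj[OF lists(1)]]
        LIMSEQ_ignore_initial_segment[OF atom_tendsto[OF assms]])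
  then show "(\<lambda>m. W (prefix ?\<omega>' m) (W_adj (prefix ?\<omega>' m) (W_adj (prefix \<omega> n) x)))
      \<longlonglongrightarrow> W_adj (prefix \<omega> n) (atom \<omega> x)"
    using lists by (simp add: add.commute[of _ n] prefix_add W_append W_adj_append W_adj_W)
qed

lemma atom_W_prefix:
  assumes "\<omega> \<in> words N"
  shows "atom \<omega> (W (prefix \<omega> n) x) = W (prefix \<omega> n) (atom ((shift ^^ n) \<omega>) x)"
  using W_W_adj_atom[OF assms, of n "W (prefix \<omega> n) x"] W_adj_atom[OF assms]
    W_adj_W[OF prefix_in_lists[OF assms]] by simp

lemma atom_W_not_prefix:
  assumes "\<omega> \<in> words N" "I \<in> lists {..<N}" "I \<noteq> prefix \<omega> (length I)"
  shows "atom \<omega> (W I x) = 0"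
proof -
  have "I = prefix \<omega> (length I)" if "\<omega> \<in> cylinder N I"
    using that by (intro nth_equalityI) (simp_all add: cylinder_def prefix_def)
  then have "\<omega> \<notin> cylinder N I" using assms(3) by blast
  then have "{\<omega>} \<inter> cylinder N I = {}" by blast
  then have "atom \<omega> (P (cylinder N I) (W I x)) = 0"
    using assms projection_valued_measureD(2,4)[OF pvm]
    by (simp add: singleton_in_sets cylinder_in_sets)
  then show ?thesis using assms(2) by (simp add: P_cylinder W_adj_W)
qed

text \<open>
  Countable additivity on the disjoint singletons gives a convergent series, whose terms tend to
  zero.
\<close>

lemma atom_tendsto_zero:
  assumes "\<And>k. \<omega> k \<in> words N" "inj \<omega>"
  shows "(\<lambda>k. atom (\<omega> k) x) \<longlonglongrightarrow> 0"
proof -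
  have "(\<lambda>k. atom (\<omega> k) x) sums P (\<Union>k. {\<omega> k}) x"
    using assms by (intro projection_valued_measureD(5)[OF pvm])
      (auto simp: disjoint_family_on_def inj_eq singleton_in_sets)
  then show ?thesis by (rule summable_LIMSEQ_zero[OF sums_summable])
qed

end


section \<open>Representations with a finite-dimensional cyclic co-invariant subspace\<close>

locale cuntz_pvm_finite = cuntz_pvm N S P
  for N S P +
  fixes M :: "'a :: complex_hilbert_space set" and B :: "'a set"
  assumes csubspace: "complex_vector.subspace M"
    and finite_B: "finite B" and span_B: "span B = M"
    and cyclic: "cyclic_for N S M"
    and coinvariant: "\<And>i. i < N \<Longrightarrow> cadjoint (S i) ` M \<subseteq> M"
begin

lemma closed_M: "closed M"
  using closed_span_finite[OF finite_B] span_B by simp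

lemma W_adj_in_M: "I \<in> lists {..<N} \<Longrightarrow> v \<in> M \<Longrightarrow> W_adj I v \<in> M"
proof (induction I arbitrary: v)
  case Nil
  then show ?case by (simp add: W_adj_Nil)
next
  case (Cons i I)
  then have i: "i < N" "[i] \<in> lists {..<N}" "I \<in> lists {..<N}" by auto
  then show ?case
    using W_adj_append[OF i(2,3)] W_adj_single[OF i(1)] Cons coinvariant[OF i(1)] by auto
qed

text \<open>
  The preimage of \<open>L\<close> under the atom is a closed subspace. It contains the generators from the
  definition of cyclicity: the adjoint word operators leave \<open>M\<close> invariant, and words that are not
  prefixes of \<open>\<omega>\<close> contribute zero.
\<close>

lemma range_atom_subset:
  assumes \<omega>: "\<omega> \<in> words N"
    and L: "closed L" "complex_vector.subspace L"
    and gen: "\<And>n v. v \<in> M \<Longrightarrow> atom \<omega> (W (prefix \<omega> n) v) \<in> L"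
  shows "range (atom \<omega>) \<subseteq> L"
proof -
  have clin: "Vector_Spaces.linear scaleC scaleC (atom \<omega>)"
    using projection_valued_measureD(1)[OF pvm singleton_in_sets[OF \<omega>]]
    by (simp add: bounded_clinear_def)
  have "W I (W_adj J v) \<in> atom \<omega> -` L" if "I \<in> lists {..<N}" "J \<in> lists {..<N}" "v \<in> M" for I J v
  proof (cases "I = prefix \<omega> (length I)")
    case True
    then show ?thesis using gen W_adj_in_M that by (metis vimageI)
  next
    case False
    then show ?thesis
      using atom_W_not_prefix[OF \<omega> that(1)] complex_vector.subspace_0[OF L(2)] by simp
  qed
  moreover have "complex_vector.subspace (atom \<omega> -` L)"
    using clin L(2) linear_0[OF linear_atom[OF \<omega>]]
    by (simp add: Vector_Spaces.linear_iff complex_vector.subspace_def)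
  ultimately have "complex_vector.span {W I (W_adj J v) | I J v.
      I \<in> lists {..<N} \<and> J \<in> lists {..<N} \<and> v \<in> M} \<subseteq> atom \<omega> -` L"
    by (intro complex_vector.span_minimal) auto
  moreover have "closed (atom \<omega> -` L)"
    using L(1) bounded_linear.continuous_on[OF bounded_linear_atom[OF \<omega>] continuous_on_id]
    by (intro closed_vimage) auto
  ultimately have "closure (complex_vector.span {W I (W_adj J v) | I J v.
      I \<in> lists {..<N} \<and> J \<in> lists {..<N} \<and> v \<in> M}) \<subseteq> atom \<omega> -` L"
    by (rule closure_minimal)
  then show ?thesis using cyclic unfolding cyclic_for_def by blast
qed

text \<open>
  Along a non-periodic orbit, the component of a vector of \<open>M\<close> in the successive atoms keeps its
  norm, while on bounded subsets of \<open>M\<close> the atoms of distinct points tend uniformly to zero.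
\<close>

lemma atom_eq_zero_if_not_periodic:
  assumes \<omega>: "\<omega> \<in> words N" and "\<not> periodic_word \<omega>"
  shows "atom \<omega> = (\<lambda>_. 0)"
proof -
  have "atom ((shift ^^ n) \<omega>) v = 0" if v: "v \<in> M" for n v
  proof -
    define \<omega>' where "\<omega>' = (shift ^^ n) \<omega>"
    have \<omega>': "\<omega>' \<in> words N" using \<omega> by (simp add: \<omega>'_def shift_in_words)
    have "inj (\<lambda>k. (shift ^^ k) \<omega>')"
    proof (rule injI)
      fix k l assume "(shift ^^ k) \<omega>' = (shift ^^ l) \<omega>'"
      then have "(shift ^^ (k + n)) \<omega> = (shift ^^ (l + n)) \<omega>"
        by (simp add: \<omega>'_def funpow_add)
      then show "k = l" using assms(2) unfolding periodic_word_def by (metis add_right_cancel)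
    qed
    then have lim: "(\<lambda>k. atom ((shift ^^ k) \<omega>') x) \<longlonglongrightarrow> 0" for x
      by (intro atom_tendsto_zero) (simp_all add: \<omega>' shift_in_words)
    have "(\<lambda>k. atom ((shift ^^ k) \<omega>') (W_adj (prefix \<omega>' k) v)) \<longlonglongrightarrow> 0"
    proof (rule tendsto_zero_uniform_on_span[where A = "\<lambda>k. atom ((shift ^^ k) \<omega>')" and K = "norm v",
          OF finite_B, unfolded span_B])
      show "linear (atom ((shift ^^ k) \<omega>'))" for k
        by (rule linear_atom[OF shift_in_words[OF \<omega>']])
      show "W_adj (prefix \<omega>' k) v \<in> M" for k
        by (rule W_adj_in_M[OF prefix_in_lists[OF \<omega>'] v])
      show "norm (W_adj (prefix \<omega>' k) v) \<le> norm v" for k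
        by (rule norm_W_adj_le[OF prefix_in_lists[OF \<omega>']])
    qed (rule lim)
    then have "(\<lambda>k. norm (atom ((shift ^^ k) \<omega>') (W_adj (prefix \<omega>' k) v))) \<longlonglongrightarrow> 0"
      by (rule tendsto_norm_zero)
    then have "(\<lambda>k::nat. norm (atom \<omega>' v)) \<longlonglongrightarrow> 0"
      unfolding W_adj_atom[OF \<omega>', symmetric] norm_W_adj_atom[OF \<omega>'] .
    then show ?thesis by (simp add: \<omega>'_def LIMSEQ_const_iff)
  qed
  then have "atom \<omega> (W (prefix \<omega> n) v) = 0" if "v \<in> M" for n v
    using that linear_0[OF bounded_linear.linear[OF bounded_linear_W[OF prefix_in_lists[OF \<omega>]]]]
    unfolding atom_W_prefix[OF \<omega>] by simp
  then have "range (atom \<omega>) \<subseteq> {0}"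
    by (intro range_atom_subset[OF \<omega>]) (simp_all add: complex_vector.subspace_single_0)
  then show ?thesis by auto
qed

text \<open>
  By covariance the adjoint maps the finite-dimensional image of \<open>M\<close> into itself, and the word
  operator is a left inverse there.
\<close>

lemma W_adj_atom_image_cycle:
  assumes \<omega>: "\<omega> \<in> words N" and "(shift ^^ n) \<omega> = \<omega>"
  shows "W_adj (prefix \<omega> n) ` atom \<omega> ` M = atom \<omega> ` M"
proof -
  have span: "span (atom \<omega> ` B) = atom \<omega> ` M"
    using linear_span_image[OF linear_atom[OF \<omega>], of B] span_B by simp
  have lin: "linear (W_adj (prefix \<omega> n))"
    using bounded_linear.linear bounded_linear_W_adj prefix_in_lists[OF \<omega>] by blast
  have "W_adj (prefix \<omega> n) ` atom \<omega> ` M \<subseteq> atom \<omega> ` M"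
    using W_adj_atom[OF \<omega>, of n] W_adj_in_M[OF prefix_in_lists[OF \<omega>]] assms(2) by auto
  moreover have "inj_on (W_adj (prefix \<omega> n)) (atom \<omega> ` M)"
    by (rule inj_on_inverseI[of _ "W (prefix \<omega> n)"]) (auto simp: W_W_adj_atom[OF \<omega>])
  ultimately show ?thesis
    using linear_inj_on_span_surj[OF lin, of "atom \<omega> ` B"] finite_B by (simp add: span)
qed

lemma funpow_shift_mult:
  assumes "(shift ^^ p) \<omega> = \<omega>"
  shows "(shift ^^ (p * k)) \<omega> = \<omega>"
  by (induction k) (simp_all add: funpow_add assms)

text \<open>
  Going around the cycle \<open>k\<close> times acts on \<open>Q\<^sub>\<omega> M\<close> as a surjective isometry, but sends the
  kernel components \<open>v - Q\<^sub>\<omega> v\<close> of the vectors \<open>v \<in> M\<close> to zero in the limit. So a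
  vector of \<open>Q\<^sub>\<omega> M\<close> is approximated by vectors of \<open>M\<close>, which is closed.
\<close>

lemma atom_image_subset_if_cycle:
  assumes \<omega>: "\<omega> \<in> words N" and p: "p > 0" "(shift ^^ p) \<omega> = \<omega>"
  shows "atom \<omega> ` M \<subseteq> M"
proof
  fix y assume y: "y \<in> atom \<omega> ` M"
  define T where "T k = W_adj (prefix \<omega> (p * k))" for k
  have T: "bounded_linear (T k)" for k
    by (simp add: T_def bounded_linear_W_adj prefix_in_lists[OF \<omega>])
  have "\<exists>z \<in> atom \<omega> ` M. T k z = y" for k
    using W_adj_atom_image_cycle[OF \<omega> funpow_shift_mult[OF p(2)], of k] y
    unfolding T_def by (metis imageE)
  then obtain z where z: "\<And>k. z k \<in> atom \<omega> ` M" "\<And>k. T k (z k) = y" by metis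
  have norm_z: "norm (z k) = norm y" for k
    using norm_W_adj_atom[OF \<omega>] z[of k] unfolding T_def by auto
  \<comment> \<open>A linear choice of preimages in \<open>M\<close> makes the lifts of a bounded sequence depend linearly on it,
    so that uniform convergence can be applied on \<open>Q\<^sub>\<omega> M\<close>.\<close>
  obtain g where g: "range g \<subseteq> M" "linear g" "\<And>x. x \<in> atom \<omega> ` M \<Longrightarrow> atom \<omega> (g x) = x"
    using linear_exists_right_inverse_on[OF linear_atom[OF \<omega>], of M] subspace_span[of B] span_B
    by metis
  have span: "span (atom \<omega> ` B) = atom \<omega> ` M"
    using linear_span_image[OF linear_atom[OF \<omega>], of B] span_B by simp
  have "(\<lambda>k. T k (atom \<omega> (g (z k)) - g (z k))) \<longlonglongrightarrow> 0"
  proof (rule tendsto_zero_uniform_on_span[where A = "\<lambda>k x. T k (atom \<omega> (g x) - g x)"])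
    show "finite (atom \<omega> ` B)" using finite_B by simp
    show "linear (\<lambda>x. T k (atom \<omega> (g x) - g x))" for k
      using linear_compose[OF linear_compose_sub[OF linear_compose[OF g(2) linear_atom[OF \<omega>]] g(2)]
          bounded_linear.linear[OF T]]
      by (simp add: comp_def)
    show "z k \<in> span (atom \<omega> ` B)" "norm (z k) \<le> norm y" for k
      using z(1) by (simp_all add: span norm_z)
    show "(\<lambda>k. T k (atom \<omega> (g x) - g x)) \<longlonglongrightarrow> 0" for x
    proof -
      define u where "u = atom \<omega> (g x) - g x"
      have "atom \<omega> u = 0"
        by (simp add: u_def linear_diff[OF linear_atom[OF \<omega>]] atom_atom[OF \<omega>])
      then have "(\<lambda>n. norm (W (prefix \<omega> n) (W_adj (prefix \<omega> n) u))) \<longlonglongrightarrow> 0"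
        using atom_tendsto[OF \<omega>, of u] by (simp add: tendsto_norm_zero)
      then have "(\<lambda>n. W_adj (prefix \<omega> n) u) \<longlonglongrightarrow> 0"
        by (simp add: norm_W prefix_in_lists[OF \<omega>] tendsto_norm_zero_iff)
      moreover have "strict_mono (\<lambda>k. p * k)" using p(1) by (simp add: strict_mono_def)
      ultimately show ?thesis
        unfolding T_def u_def[symmetric] using LIMSEQ_subseq_LIMSEQ[of _ 0 "\<lambda>k. p * k"]
        by (simp add: comp_def)
    qed
  qed
  moreover have "T k (atom \<omega> (g (z k)) - g (z k)) = y - T k (g (z k))" for k
    using g(3)[OF z(1)] z(2) bounded_linear.linear[OF T] by (simp add: linear_diff)
  ultimately have "(\<lambda>k. y - T k (g (z k))) \<longlonglongrightarrow> 0" by simp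
  then have "(\<lambda>k. y - (y - T k (g (z k)))) \<longlonglongrightarrow> y - 0" by (intro tendsto_intros)
  then have "(\<lambda>k. T k (g (z k))) \<longlonglongrightarrow> y" by simp
  moreover have "T k (g (z k)) \<in> M" for k
    unfolding T_def using g(1) by (intro W_adj_in_M prefix_in_lists[OF \<omega>]) auto
  ultimately show "y \<in> M"
    using closed_sequentially[OF closed_M, of "\<lambda>k. T k (g (z k))"] by blast
qed

text \<open>
  A vector \<open>S\<^sub>I Q v\<close>, with \<open>Q\<close> the atom at \<open>\<sigma>\<^sup>n \<omega>\<close>, is brought back to the image of \<open>M\<close> under the
  atom at \<open>\<omega>\<close> by reading on until a whole number of turns around the cycle is completed.
\<close>

lemma range_atom_subset_if_cyclic:
  assumes \<omega>: "\<omega> \<in> words N" and "cyclic_word \<omega>"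
  shows "range (atom \<omega>) \<subseteq> M"
proof (rule range_atom_subset[OF \<omega> closed_M csubspace])
  obtain p where p: "p > 0" "(shift ^^ p) \<omega> = \<omega>"
    using assms(2) by (auto simp: cyclic_word_def)
  fix n v assume v: "v \<in> M"
  define \<omega>' where "\<omega>' = (shift ^^ n) \<omega>"
  \<comment> \<open>The number of letters from position \<open>n\<close> up to the end of the \<open>n\<close>-th turn, which is not before
    position \<open>n\<close> since \<open>p > 0\<close>.\<close>
  define m where "m = p * n - n"
  have nm: "n + m = p * n" using p(1) by (simp add: m_def)
  have \<omega>': "\<omega>' \<in> words N" using \<omega> by (simp add: \<omega>'_def shift_in_words)
  have return: "(shift ^^ m) \<omega>' = \<omega>"
    using funpow_shift_mult[OF p(2), of n] unfolding \<omega>'_def nm[symmetric]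
    by (simp add: add.commute[of n] funpow_add)
  have "atom \<omega> (W (prefix \<omega> n) v) = W (prefix \<omega> n) (atom \<omega>' v)"
    by (simp add: atom_W_prefix[OF \<omega>] \<omega>'_def)
  also have "\<dots> = W (prefix \<omega> n) (W (prefix \<omega>' m) (W_adj (prefix \<omega>' m) (atom \<omega>' v)))"
    by (simp add: W_W_adj_atom[OF \<omega>'])
  also have "\<dots> = W (prefix \<omega> (p * n)) (atom \<omega> (W_adj (prefix \<omega>' m) v))"
    unfolding W_adj_atom[OF \<omega>'] return nm[symmetric] prefix_add W_append \<omega>'_def[symmetric] ..
  also have "\<dots> \<in> atom \<omega> ` M"
  proof -
    have "atom \<omega> (W_adj (prefix \<omega>' m) v) \<in> W_adj (prefix \<omega> (p * n)) ` atom \<omega> ` M"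
      unfolding W_adj_atom_image_cycle[OF \<omega> funpow_shift_mult[OF p(2)]]
      by (rule imageI) (rule W_adj_in_M[OF prefix_in_lists[OF \<omega>'] v])
    then show ?thesis by (auto simp: W_W_adj_atom[OF \<omega>])
  qed
  finally show "atom \<omega> (W (prefix \<omega> n) v) \<in> M"
    using atom_image_subset_if_cycle[OF \<omega> p] by blast
qed

end

theorem corollary4p19:
  fixes N :: nat
    and S :: "nat \<Rightarrow> 'h \<Rightarrow> 'h :: complex_hilbert_space"
    and P :: "(nat \<Rightarrow> nat) set \<Rightarrow> 'h \<Rightarrow> 'h"
    and M :: "'h set"
  assumes "N \<ge> 2"
    and "cuntz_representation N S"
    and "associated_pvm N S P"
    and "purely_atomic N P"
    and "complex_vector.subspace M"
    and "cfinite_dimensional M"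
    and "cyclic_for N S M"
    and "\<And>i. i < N \<Longrightarrow> cadjoint (S i) ` M \<subseteq> M"
  shows "(\<forall>\<omega> \<in> pvm_support N P. periodic_word \<omega>) \<and>
         (\<forall>\<omega> \<in> pvm_support N P. cyclic_word \<omega> \<longrightarrow> range (P {\<omega>}) \<subseteq> M)"
proof -
  obtain B0 where "finite B0" "complex_vector.span B0 = M"
    using assms(6) by (auto simp: cfinite_dimensional_def)
  then interpret cuntz_pvm_finite N S P M "B0 \<union> scaleC \<i> ` B0"
    using assms by unfold_locales (simp_all add: complex_span_conv_real_span)
  show ?thesis
    using atom_eq_zero_if_not_periodic range_atom_subset_if_cyclic
    unfolding pvm_support_def by blast
qed

end
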